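(* Let $\Delta T_{\mathrm{res}}>0$ and let $(\Delta T_{\mathrm{lim},k})_{k\ge 0}$ be a deterministic real sequence with $|\Delta T_{\mathrm{lim},k}|\le \Delta T_{\mathrm{res}}$ for all $k$. At each time step $k$, refrigerator $i$ changes its thermostat temperature limits by $\Delta T_{\mathrm{res}}$ in the direction of the sign of $\Delta T_{\mathrm{lim},k}$ with probability $\varrho_k=|\Delta T_{\mathrm{lim},k}|/\Delta T_{\mathrm{res}}$, and leaves them unchanged with probability $1-\varrho_k$, the random decisions at different time steps being uncorrelated. Let $\Delta T_{\mathrm{lim},i,t}$ denote the total change of the temperature limits of refrigerator $i$ over the time steps $0,\dots,t-1$. Then $$\mathbb{E}[\Delta T_{\mathrm{lim},i,t}]=\sum_{k=0}^{t-1}\Delta T_{\mathrm{lim},k},\qquad \mathrm{Var}[\Delta T_{\mathrm{lim},i,t}]=\sum_{k=0}^{t-1}|\Delta T_{\mathrm{lim},k}|\,\big(\Delta T_{\mathrm{res}}-|\Delta T_{\mathrm{lim},k}|\big).$$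
   Context: $\Delta T_{\mathrm{lim},k}$ is the required change of temperature limits at time step $k$ computed by the controller (the same for all refrigerators), and $\Delta T_{\mathrm{res}}$ is the fixed (minimum resolution) amount by which the limits of an individual device can change in one step. Formally, $\Delta T_{\mathrm{lim},i,t}=\sum_{k=0}^{t-1}\Delta T_{\mathrm{res}}\,\zeta_k z_k$, where $\zeta_k\in\{1,-1\}$ is the sign of $\Delta T_{\mathrm{lim},k}$ (either value if $\Delta T_{\mathrm{lim},k}=0$) and the $z_k$ are pairwise uncorrelated Bernoulli random variables with $\mathbb{P}(z_k=1)=\varrho_k$. Device lockout is neglected. *)

theory Defs
  imports "HOL-Probability.Probability"
begin

definition covariance :: "'a measure \<Rightarrow> ('a \<Rightarrow> real) \<Rightarrow> ('a \<Rightarrow> real) \<Rightarrow> real" where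
  "covariance M X Y =
     prob_space.expectation M (\<lambda>\<omega>. (X \<omega> - prob_space.expectation M X) * (Y \<omega> - prob_space.expectation M Y))"

text \<open>Pairwise, and weaker than pairwise independence of the family in general.  Without
  square integrability the covariance may be a default value; the definition is meant for
  square-integrable (here: almost surely bounded) random variables.\<close>

definition pairwise_uncorrelated :: "'a measure \<Rightarrow> (nat \<Rightarrow> 'a \<Rightarrow> real) \<Rightarrow> bool" where
  "pairwise_uncorrelated M z \<longleftrightarrow> (\<forall>k l. k \<noteq> l \<longrightarrow> covariance M (z k) (z l) = 0)"

text \<open>The library's Bernoulli distribution lives on \<^typ>\<open>bool\<close>; the values 0 and 1 come from
  its image under \<^const>\<open>of_bool\<close>.  The distribution clips its parameter to the unit interval,
  so only parameters between 0 and 1 are meaningful.\<close>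

definition bernoulli_variable :: "'a measure \<Rightarrow> real \<Rightarrow> ('a \<Rightarrow> real) \<Rightarrow> bool" where
  "bernoulli_variable M p X \<longleftrightarrow>
     X \<in> borel_measurable M \<and>
     distr M borel X = distr (measure_pmf (bernoulli_pmf p)) borel of_bool"

text \<open>Total change of the limits of one device over the steps \<open>0, \<dots>, t - 1\<close>:
  the device moves its limits by \<open>dT_res\<close> in direction \<open>\<zeta> k\<close> iff \<open>z k\<close> takes the value 1.\<close>

definition total_limit_change ::
    "real \<Rightarrow> (nat \<Rightarrow> real) \<Rightarrow> (nat \<Rightarrow> 'a \<Rightarrow> real) \<Rightarrow> nat \<Rightarrow> 'a \<Rightarrow> real" where
  "total_limit_change dT_res \<zeta> z t \<omega> = (\<Sum>k<t. dT_res * \<zeta> k * z k \<omega>)"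

end

theory Submission
  imports Defs
begin

text \<open>
  The total change is a linear combination of the variables \<open>z k\<close>, with the deterministic
  coefficients \<open>dT_res * \<zeta> k\<close>.  Linearity gives its mean; since the variables are
  pairwise uncorrelated, every mixed term in the expansion of the squared deviation integrates to
  zero, so the variance is the sum of the squared coefficients times the individual variances
  (\<open>variance_linear_combination_uncorrelated\<close>).  A Bernoulli variable with parameter \<open>p\<close> has mean
  \<open>p\<close> and variance \<open>p * (1 - p)\<close>, because expectations of functions of it can be computed on
  the two-point space (\<open>bernoulli_variable_integral\<close>).  The choice \<open>p = \<bar>dT_lim k\<bar> / dT_res\<close> makes
  each randomized step unbiased: its mean is \<open>\<zeta> k * \<bar>dT_lim k\<bar> = dT_lim k\<close>, and its variance
  \<open>dT_res\<^sup>2 * p * (1 - p)\<close> is \<open>\<bar>dT_lim k\<bar> * (dT_res - \<bar>dT_lim k\<bar>)\<close>.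
\<close>

text \<open>Change of variables: only the distribution of \<open>X\<close> matters, and it is the image of a
  distribution on two points, where every function is integrable.\<close>

lemma bernoulli_variable_integral:
  fixes g :: "real \<Rightarrow> real"
  assumes X: "bernoulli_variable M p X" and p: "0 \<le> p" "p \<le> 1"
    and g: "g \<in> borel_measurable borel"
  shows "integrable M (\<lambda>\<omega>. g (X \<omega>))"
    and "integral\<^sup>L M (\<lambda>\<omega>. g (X \<omega>)) = p * g 1 + (1 - p) * g 0"
proof -
  have X_meas: "X \<in> borel_measurable M"
    and X_distr: "distr M borel X = distr (measure_pmf (bernoulli_pmf p)) borel of_bool"
    using X by (auto simp: bernoulli_variable_def)
  have "integrable (measure_pmf (bernoulli_pmf p)) (\<lambda>b. g (of_bool b))"
    by (rule integrable_measure_pmf_finite) simp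
  then have "integrable (distr M borel X) g"
    unfolding X_distr using g by (subst integrable_distr_eq) auto
  then show "integrable M (\<lambda>\<omega>. g (X \<omega>))"
    using g X_meas by (subst (asm) integrable_distr_eq) auto
  have "integral\<^sup>L M (\<lambda>\<omega>. g (X \<omega>)) = integral\<^sup>L (distr M borel X) g"
    using g X_meas by (simp add: integral_distr)
  also have "\<dots> = integral\<^sup>L (measure_pmf (bernoulli_pmf p)) (\<lambda>b. g (of_bool b))"
    unfolding X_distr using g by (subst integral_distr) auto
  also have "\<dots> = p * g 1 + (1 - p) * g 0"
    using p by simp
  finally show "integral\<^sup>L M (\<lambda>\<omega>. g (X \<omega>)) = p * g 1 + (1 - p) * g 0" .
qed

lemma bernoulli_variable_moments:
  assumes X: "bernoulli_variable M p X" and p: "0 \<le> p" "p \<le> 1"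
  shows "integrable M X" and "integrable M (\<lambda>\<omega>. (X \<omega>)\<^sup>2)"
    and "integral\<^sup>L M X = p"
    and "integral\<^sup>L M (\<lambda>\<omega>. (X \<omega> - p)\<^sup>2) = p * (1 - p)"
proof -
  show "integrable M X" "integral\<^sup>L M X = p"
    using bernoulli_variable_integral[OF X p, of "\<lambda>x. x"] by simp_all
  show "integrable M (\<lambda>\<omega>. (X \<omega>)\<^sup>2)"
    using bernoulli_variable_integral(1)[OF X p, of "\<lambda>x. x\<^sup>2"] by simp
  show "integral\<^sup>L M (\<lambda>\<omega>. (X \<omega> - p)\<^sup>2) = p * (1 - p)"
    using bernoulli_variable_integral(2)[OF X p, of "\<lambda>x. (x - p)\<^sup>2"]
    by (simp add: power2_eq_square algebra_simps)
qed

lemma integrable_mult_of_square_integrable: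
  fixes f g :: "'a \<Rightarrow> real"
  assumes "f \<in> borel_measurable M" "g \<in> borel_measurable M"
    and "integrable M (\<lambda>x. (f x)\<^sup>2)" "integrable M (\<lambda>x. (g x)\<^sup>2)"
  shows "integrable M (\<lambda>x. f x * g x)"
proof (rule Bochner_Integration.integrable_bound)
  show "integrable M (\<lambda>x. (f x)\<^sup>2 + (g x)\<^sup>2)"
    using assms by simp
  have "\<bar>a * b\<bar> \<le> a\<^sup>2 + b\<^sup>2" for a b :: real
  proof -
    have "2 * (\<bar>a\<bar> * \<bar>b\<bar>) \<le> a\<^sup>2 + b\<^sup>2"
      using sum_squares_bound[of "\<bar>a\<bar>" "\<bar>b\<bar>"] by simp
    moreover have "0 \<le> \<bar>a\<bar> * \<bar>b\<bar>"
      by simp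
    ultimately show ?thesis
      unfolding abs_mult by linarith
  qed
  then show "AE x in M. norm (f x * g x) \<le> norm ((f x)\<^sup>2 + (g x)\<^sup>2)"
    by simp
qed (use assms in simp)

text \<open>Bienayme's identity.  Square integrability ensures that the mixed products are integrable,
  so that the expectation may be taken term by term.\<close>

lemma variance_linear_combination_uncorrelated:
  fixes X :: "nat \<Rightarrow> 'a \<Rightarrow> real" and a :: "nat \<Rightarrow> real"
  assumes "prob_space M"
    and int: "\<And>k. integrable M (X k)"
    and int2: "\<And>k. integrable M (\<lambda>\<omega>. (X k \<omega>)\<^sup>2)"
    and uncorr: "pairwise_uncorrelated M X"
    and "finite A"
  shows "prob_space.variance M (\<lambda>\<omega>. \<Sum>k\<in>A. a k * X k \<omega>)
       = (\<Sum>k\<in>A. (a k)\<^sup>2 * prob_space.variance M (X k))"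
proof -
  interpret prob_space M by fact
  define D where "D k \<omega> = X k \<omega> - expectation (X k)" for k \<omega>
  have D_meas: "D k \<in> borel_measurable M" for k
    unfolding D_def using borel_measurable_integrable[OF int[of k]] by measurable
  have D_sq: "integrable M (\<lambda>\<omega>. (D k \<omega>)\<^sup>2)" for k
    unfolding D_def power2_diff using int[of k] int2[of k] by simp
  have DD_int: "integrable M (\<lambda>\<omega>. D k \<omega> * D l \<omega>)" for k l
    by (intro integrable_mult_of_square_integrable D_meas D_sq)
  have DD_zero: "expectation (\<lambda>\<omega>. D k \<omega> * D l \<omega>) = 0" if "k \<noteq> l" for k l
    using uncorr that by (simp add: pairwise_uncorrelated_def covariance_def D_def)
  have centred: "(\<Sum>k\<in>A. a k * X k \<omega>) - expectation (\<lambda>\<omega>. \<Sum>k\<in>A. a k * X k \<omega>)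
      = (\<Sum>k\<in>A. a k * D k \<omega>)" for \<omega>
    using int by (simp add: D_def right_diff_distrib sum_subtractf)
  have "variance (\<lambda>\<omega>. \<Sum>k\<in>A. a k * X k \<omega>)
      = expectation (\<lambda>\<omega>. \<Sum>k\<in>A. \<Sum>l\<in>A. a k * a l * (D k \<omega> * D l \<omega>))"
    unfolding centred by (simp add: power2_eq_square sum_product mult_ac)
  also have "\<dots> = (\<Sum>k\<in>A. \<Sum>l\<in>A. a k * a l * expectation (\<lambda>\<omega>. D k \<omega> * D l \<omega>))"
    using DD_int by simp
  also have "\<dots> = (\<Sum>k\<in>A. \<Sum>l\<in>A. if l = k then (a k)\<^sup>2 * expectation (\<lambda>\<omega>. (D k \<omega>)\<^sup>2) else 0)"
    by (intro sum.cong refl) (auto simp: DD_zero power2_eq_square)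
  also have "\<dots> = (\<Sum>k\<in>A. (a k)\<^sup>2 * expectation (\<lambda>\<omega>. (D k \<omega>)\<^sup>2))"
    using \<open>finite A\<close> by simp
  finally show ?thesis
    by (simp add: D_def)
qed


theorem proposition3:
  fixes M :: "'a measure"
    and dT_res :: real
    and dT_lim :: "nat \<Rightarrow> real"
    and \<zeta> :: "nat \<Rightarrow> real"
    and z :: "nat \<Rightarrow> 'a \<Rightarrow> real"
    and \<rho> :: "nat \<Rightarrow> real"
    and t :: nat
  assumes "prob_space M"
    and "dT_res > 0"
    and "\<And>k. \<bar>dT_lim k\<bar> \<le> dT_res"
    and "\<And>k. \<zeta> k \<in> {1, -1}"
    and "\<And>k. dT_lim k \<noteq> 0 \<Longrightarrow> \<zeta> k = sgn (dT_lim k)"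
    and "\<And>k. \<rho> k = \<bar>dT_lim k\<bar> / dT_res"
    and "\<And>k. bernoulli_variable M (\<rho> k) (z k)"
    and "pairwise_uncorrelated M z"
  shows "prob_space.expectation M (total_limit_change dT_res \<zeta> z t) = (\<Sum>k<t. dT_lim k)
       \<and> prob_space.variance M (total_limit_change dT_res \<zeta> z t)
           = (\<Sum>k<t. \<bar>dT_lim k\<bar> * (dT_res - \<bar>dT_lim k\<bar>))"
proof -
  interpret prob_space M by fact
  have \<rho>: "0 \<le> \<rho> k" "\<rho> k \<le> 1" for k
    using assms(2,3,6) by simp_all
  note moments = bernoulli_variable_moments[OF assms(7) \<rho>]
  have total: "total_limit_change dT_res \<zeta> z t = (\<lambda>\<omega>. \<Sum>k<t. (dT_res * \<zeta> k) * z k \<omega>)"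
    by (rule ext) (simp add: total_limit_change_def)
  (* At dT_lim k = 0 the sign is arbitrary, but then both sides vanish. *)
  have step_mean: "dT_res * \<zeta> k * \<rho> k = dT_lim k" for k
    using assms(2) assms(5)[of k] assms(6)[of k]
    by (cases "dT_lim k = 0") (simp_all add: sgn_mult_abs)
  have step_variance:
    "(dT_res * \<zeta> k)\<^sup>2 * (\<rho> k * (1 - \<rho> k)) = \<bar>dT_lim k\<bar> * (dT_res - \<bar>dT_lim k\<bar>)" for k
  proof -
    have "(\<zeta> k)\<^sup>2 = 1"
      using assms(4)[of k] by auto
    moreover have "dT_res * \<rho> k = \<bar>dT_lim k\<bar>"
      using assms(2,6) by simp
    ultimately show ?thesis
      by algebra
  qed
  have "expectation (total_limit_change dT_res \<zeta> z t) = (\<Sum>k<t. dT_lim k)"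
    unfolding total using moments(1,3) by (simp add: step_mean)
  moreover have "variance (total_limit_change dT_res \<zeta> z t)
      = (\<Sum>k<t. \<bar>dT_lim k\<bar> * (dT_res - \<bar>dT_lim k\<bar>))"
    unfolding total
    using variance_linear_combination_uncorrelated[OF assms(1) moments(1,2) assms(8),
        of "{..<t}" "\<lambda>k. dT_res * \<zeta> k"]
    by (simp add: moments(3,4) step_variance)
  ultimately show ?thesis ..
qed

end
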